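(* Let $K\in(0,1]$ and let $H:[0,\infty)\to[\mu,\nu]\subset(0,1)$ be a Hölder continuous function with exponent $\beta>0$. Then the process $B^{H(\cdot),K}$ has long range dependence in the sense (b). If, for all $s$, $K(H(t)+H(s))>1$ for all sufficiently large $t$, then $B^{H(\cdot),K}$ has long range dependence in the sense (a), with functional long range dependence exponent $\alpha(s)=KH(s)-1$. (The senses (a) and (b) are those defined in the context.)
   Context: $B^{H(\cdot),K}=(B^{H(t),K}_t)_{t\ge 0}$ denotes the centred Gaussian process, starting from zero, with covariance function $$R^{H(\cdot),K}(t,s)=\big(D(H(t),H(s))\big)^{K}\Big[\big(t^{H(t)+H(s)}+s^{H(t)+H(s)}\big)^{K}-|t-s|^{(H(t)+H(s))K}\Big],\qquad s,t\ge 0,$$ where for $x,y\in(0,1)$ $$D(x,y):=\frac{\sqrt{\Gamma(2x+1)\Gamma(2y+1)\sin(\pi x)\sin(\pi y)}}{2\,\Gamma(x+y+1)\sin\big(\frac{\pi(x+y)}{2}\big)}$$ and $\Gamma$ is the Gamma function. For a second-order process $Y$, write $cor_Y(s,t)=\dfrac{cov_Y(s,t)}{\sqrt{\mathbb{E}(Y^2(s))\,\mathbb{E}(Y^2(t))}}$. The notation $f(t)\approx g(t)$ as $t\to\infty$ means that there exist $0<c<d<+\infty$ such that $c\le f(t)/g(t)\le d$ for all sufficiently large $t$. Long range dependence, sense (a): there exists a function $\alpha(s)$ with values in $(-1,0)$, called the functional long range dependence exponent, such that for all $s\ge 0$, $cor_Y(s,s+h)\approx h^{\alpha(s)}$ as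 $h\to+\infty$. Long range dependence, sense (b): for all $s\ge 0$ and all $\delta\ge 0$, $\sum_{k=0}^{+\infty}|cor_Y(s,s+k\delta)|=+\infty$.
   Formalization: In senses (a) and (b) the base time ranges over s > 0 instead of s ≥ 0, because the process starts from zero and so cor(0, t) is 0/0, undefined. *)

theory Defs
  imports "HOL-Probability.Probability"
begin

text \<open>
  Point masses count as (degenerate) normal distributions: a centred Gaussian process with
  variance \<open>0\<close> at time \<open>0\<close> is constant there.
\<close>

definition gaussian_variable :: "'a measure \<Rightarrow> ('a \<Rightarrow> real) \<Rightarrow> bool" where
  "gaussian_variable M X \<longleftrightarrow> X \<in> borel_measurable M \<and>
     (\<exists>m. (AE \<omega> in M. X \<omega> = m) \<or>
          (\<exists>\<sigma>>0. distributed M lborel X (\<lambda>x. ennreal (normal_density m \<sigma> x))))"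

text \<open>
  Processes are indexed by the half-line; values at negative times are ignored. Joint normality of
  the finite-dimensional marginals is expressed through finite linear combinations.
\<close>

definition gaussian_process :: "'a measure \<Rightarrow> (real \<Rightarrow> 'a \<Rightarrow> real) \<Rightarrow> bool" where
  "gaussian_process M Y \<longleftrightarrow>
     (\<forall>T c. finite T \<and> T \<subseteq> {0..} \<longrightarrow> gaussian_variable M (\<lambda>\<omega>. \<Sum>t\<in>T. c t * Y t \<omega>))"

definition covariance :: "'a measure \<Rightarrow> ('a \<Rightarrow> real) \<Rightarrow> ('a \<Rightarrow> real) \<Rightarrow> real" where
  "covariance M X Z =
     (LINT \<omega>|M. (X \<omega> - (LINT \<omega>'|M. X \<omega>')) * (Z \<omega> - (LINT \<omega>'|M. Z \<omega>')))"

text \<open>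
  At a time where the second moment vanishes the quotient is \<open>0 / 0\<close>, i.e. \<open>0\<close> here.
\<close>

definition cor :: "'a measure \<Rightarrow> (real \<Rightarrow> 'a \<Rightarrow> real) \<Rightarrow> real \<Rightarrow> real \<Rightarrow> real" where
  "cor M Y s t = covariance M (Y s) (Y t) /
     sqrt ((LINT \<omega>|M. (Y s \<omega>)\<^sup>2) * (LINT \<omega>|M. (Y t \<omega>)\<^sup>2))"

definition same_order_at_top :: "(real \<Rightarrow> real) \<Rightarrow> (real \<Rightarrow> real) \<Rightarrow> bool" where
  "same_order_at_top f g \<longleftrightarrow>
     (\<exists>c d. 0 < c \<and> c < d \<and> (\<forall>\<^sub>F t in at_top. c \<le> f t / g t \<and> f t / g t \<le> d))"

text \<open>
  In both senses of long range dependence the base time ranges over \<open>s > 0\<close>: for a process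
  starting from zero the correlation with time \<open>0\<close> is undefined.
\<close>

definition lrd_functional_exponent ::
    "'a measure \<Rightarrow> (real \<Rightarrow> 'a \<Rightarrow> real) \<Rightarrow> (real \<Rightarrow> real) \<Rightarrow> bool" where
  "lrd_functional_exponent M Y \<alpha> \<longleftrightarrow>
     (\<forall>s\<ge>0. \<alpha> s \<in> {-1<..<0}) \<and>
     (\<forall>s>0. same_order_at_top (\<lambda>h. cor M Y s (s + h)) (\<lambda>h. h powr \<alpha> s))"

definition long_range_dependent_a :: "'a measure \<Rightarrow> (real \<Rightarrow> 'a \<Rightarrow> real) \<Rightarrow> bool" where
  "long_range_dependent_a M Y \<longleftrightarrow> (\<exists>\<alpha>. lrd_functional_exponent M Y \<alpha>)"

definition long_range_dependent_b :: "'a measure \<Rightarrow> (real \<Rightarrow> 'a \<Rightarrow> real) \<Rightarrow> bool" where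
  "long_range_dependent_b M Y \<longleftrightarrow>
     (\<forall>s>0. \<forall>\<delta>\<ge>0. (\<Sum>k. ennreal \<bar>cor M Y s (s + real k * \<delta>)\<bar>) = \<infinity>)"

definition hoelder_continuous_on :: "real \<Rightarrow> real set \<Rightarrow> (real \<Rightarrow> real) \<Rightarrow> bool" where
  "hoelder_continuous_on \<beta> S f \<longleftrightarrow>
     (\<exists>C. \<forall>x\<in>S. \<forall>y\<in>S. \<bar>f x - f y\<bar> \<le> C * \<bar>x - y\<bar> powr \<beta>)"

definition D_factor :: "real \<Rightarrow> real \<Rightarrow> real" where
  "D_factor x y =
     sqrt (Gamma (2 * x + 1) * Gamma (2 * y + 1) * sin (pi * x) * sin (pi * y)) /
     (2 * Gamma (x + y + 1) * sin (pi * (x + y) / 2))"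

definition R_cov :: "(real \<Rightarrow> real) \<Rightarrow> real \<Rightarrow> real \<Rightarrow> real \<Rightarrow> real" where
  "R_cov H K t s =
     D_factor (H t) (H s) powr K *
     ((t powr (H t + H s) + s powr (H t + H s)) powr K - \<bar>t - s\<bar> powr ((H t + H s) * K))"

definition bifractional_mbm ::
    "'a measure \<Rightarrow> (real \<Rightarrow> real) \<Rightarrow> real \<Rightarrow> (real \<Rightarrow> 'a \<Rightarrow> real) \<Rightarrow> bool" where
  "bifractional_mbm M H K B \<longleftrightarrow>
     prob_space M \<and> gaussian_process M B \<and>
     (AE \<omega> in M. B 0 \<omega> = 0) \<and>
     (\<forall>t\<ge>0. (LINT \<omega>|M. B t \<omega>) = 0) \<and>
     (\<forall>t\<ge>0. \<forall>s\<ge>0. covariance M (B t) (B s) = R_cov H K t s)"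

end

theory Submission
  imports Defs
begin

text \<open>
  The means vanish, so all second moments, and hence the correlations, are read off the covariance
  function \<open>R_cov\<close>. Since \<open>D_factor x x = 1/2\<close>, the variance at time \<open>t > 0\<close> is
  \<open>t powr (2 * K * H t)\<close>, and factoring the powers of \<open>t\<close> out of the covariance gives, for \<open>0 < s \<le> t\<close>, \<open>x = s / t\<close> and \<open>a = H s + H t\<close>,
  the exact formula (\<open>cor_bifractional_mbm\<close>)
  \[ cor(s,t) = D(H_s,H_t)^K \, (t/s)^{K H_s} \, ((1 + x^a)^K - (1 - x)^{aK}) . \]

  The factor \<open>D\<close> is harmless: it is the ratio of a geometric mean of two values of
  \<open>f x = \<Gamma> (2 * x + 1) * sin (pi * x)\<close> to twice the value of \<open>f\<close> at their midpoint, and \<open>f\<close> is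
  bounded away from \<open>0\<close> and \<open>\<infinity>\<close> on \<open>[\<mu>, \<nu>]\<close> (\<open>D_factor_bounds\<close>).

  The last factor is a sum of two competing terms, of order \<open>x powr a\<close> and \<open>x\<close>. It is always at least
  a multiple of \<open>x\<close> (\<open>increment_ge\<close>), which makes the correlation at least of order \<open>1 / t\<close>; along
  an arithmetic progression of times the series then dominates the harmonic one, which is sense (b).
  If moreover \<open>a * K \<ge> 1\<close>, then \<open>a \<ge> 1\<close> because \<open>K \<le> 1\<close>, so the term \<open>x powr a\<close> is at most \<open>x\<close> and
  the factor is of exact order \<open>x\<close> (\<open>increment_le\<close>). The unknown \<open>H t\<close> has then
  disappeared from the order of magnitude, and what is left is \<open>t powr (K * H s) / t\<close>, which is
  sense (a) with exponent \<open>K * H s - 1\<close>.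
\<close>

section \<open>The normalising factor\<close>

definition Gamma_sin :: "real \<Rightarrow> real" where
  "Gamma_sin x = Gamma (2 * x + 1) * sin (pi * x)"

lemma Gamma_sin_pos:
  assumes "0 < x" "x < 1"
  shows "0 < Gamma_sin x"
  unfolding Gamma_sin_def
  using assms by (intro mult_pos_pos Gamma_real_pos sin_gt_zero) auto

lemma D_factor_eq: "D_factor x y = sqrt (Gamma_sin x * Gamma_sin y) / (2 * Gamma_sin ((x + y) / 2))"
proof -
  have "2 * ((x + y) / 2) = x + y" by simp
  then show ?thesis by (simp only: D_factor_def Gamma_sin_def mult_ac times_divide_eq_right)
qed

lemma D_factor_same:
  assumes "0 < x" "x < 1"
  shows "D_factor x x = 1 / 2"
  using Gamma_sin_pos[OF assms] by (simp add: D_factor_eq)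

lemma D_factor_bounds:
  assumes "0 < \<mu>" "\<nu> < 1"
  obtains l u where "0 < l" "\<And>x y. x \<in> {\<mu>..\<nu>} \<Longrightarrow> y \<in> {\<mu>..\<nu>} \<Longrightarrow> l \<le> D_factor x y"
    "\<And>x y. x \<in> {\<mu>..\<nu>} \<Longrightarrow> y \<in> {\<mu>..\<nu>} \<Longrightarrow> D_factor x y \<le> u"
proof (cases "\<mu> \<le> \<nu>")
  case False
  then show ?thesis using that[of 1 0] by auto
next
  case True
  have cont: "continuous_on {\<mu>..\<nu>} Gamma_sin"
    unfolding Gamma_sin_def using assms
    by (intro continuous_at_imp_continuous_on ballI continuous_intros)
       (auto elim!: nonpos_Ints_cases)
  have ne: "{\<mu>..\<nu>} \<noteq> {}" using True by auto
  obtain p where p: "p \<in> {\<mu>..\<nu>}" "\<And>x. x \<in> {\<mu>..\<nu>} \<Longrightarrow> Gamma_sin p \<le> Gamma_sin x"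
    using continuous_attains_inf[OF compact_Icc ne cont] by blast
  obtain q where q: "q \<in> {\<mu>..\<nu>}" "\<And>x. x \<in> {\<mu>..\<nu>} \<Longrightarrow> Gamma_sin x \<le> Gamma_sin q"
    using continuous_attains_sup[OF compact_Icc ne cont] by blast
  define m N where "m = Gamma_sin p" and "N = Gamma_sin q"
  have m: "0 < m" unfolding m_def using p(1) assms by (intro Gamma_sin_pos) auto
  have N: "0 < N" unfolding N_def using q(1) assms by (intro Gamma_sin_pos) auto
  have bd: "m \<le> Gamma_sin x" "Gamma_sin x \<le> N" if "x \<in> {\<mu>..\<nu>}" for x
    using p(2) q(2) that by (auto simp: m_def N_def)
  have sqrt_bd: "m \<le> sqrt (Gamma_sin x * Gamma_sin y)" "sqrt (Gamma_sin x * Gamma_sin y) \<le> N"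
    if x: "x \<in> {\<mu>..\<nu>}" and y: "y \<in> {\<mu>..\<nu>}" for x y
  proof -
    have "m * m \<le> Gamma_sin x * Gamma_sin y"
      using bd(1)[OF x] bd(1)[OF y] m by (intro mult_mono) auto
    then show "m \<le> sqrt (Gamma_sin x * Gamma_sin y)"
      by (intro real_le_rsqrt) (simp add: power2_eq_square)
    have "Gamma_sin x * Gamma_sin y \<le> N * N"
      using bd[OF x] bd[OF y] m by (intro mult_mono) auto
    then show "sqrt (Gamma_sin x * Gamma_sin y) \<le> N"
      using N by (intro real_le_lsqrt) (auto simp: power2_eq_square)
  qed
  have mid: "(x + y) / 2 \<in> {\<mu>..\<nu>}" if "x \<in> {\<mu>..\<nu>}" "y \<in> {\<mu>..\<nu>}" for x y
    using that by auto
  show ?thesis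
  proof (rule that[of "m / (2 * N)" "N / (2 * m)"])
    show "0 < m / (2 * N)" using m N by simp
  next
    fix x y assume xy: "x \<in> {\<mu>..\<nu>}" "y \<in> {\<mu>..\<nu>}"
    show "m / (2 * N) \<le> D_factor x y" unfolding D_factor_eq
      using sqrt_bd[OF xy] bd[OF mid[OF xy]] m by (intro frac_le; linarith)
    show "D_factor x y \<le> N / (2 * m)" unfolding D_factor_eq
      using sqrt_bd[OF xy] bd[OF mid[OF xy]] m N by (intro frac_le) auto
  qed
qed

section \<open>The normalised increment\<close>

text \<open>
  Only \<open>1 - (1 - x) powr (a * K)\<close> is used; decreasing the exponent to some \<open>q \<le> 1\<close> makes it
  smaller, and then concavity of the power, in the form of Young's inequality, applies.
\<close>

lemma increment_ge:
  fixes x a K q :: real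
  assumes "0 \<le> x" "x \<le> 1" "0 \<le> K" "0 < q" "q \<le> 1" "q \<le> a * K"
  shows "q * x \<le> (1 + x powr a) powr K - (1 - x) powr (a * K)"
proof -
  have "(1 - x) powr (a * K) \<le> 1 - q * x"
  proof (cases "x = 1")
    case True
    then show ?thesis using assms by simp
  next
    case False
    then have "(1 - x) powr (a * K) \<le> (1 - x) powr q"
      using assms by (intro powr_mono') auto
    also have "\<dots> = (1 - x) powr q * 1 powr (1 - q)" by simp
    also have "\<dots> \<le> q * (1 - x) + (1 - q) * 1"
      using assms False by (intro Youngs_inequality_0) auto
    also have "\<dots> = 1 - q * x" by (simp add: algebra_simps)
    finally show ?thesis .
  qed
  moreover have "1 \<le> (1 + x powr a) powr K"
    using assms by (intro ge_one_powr_ge_zero) auto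
  ultimately show ?thesis by linarith
qed

text \<open>
  Here \<open>1 \<le> a\<close>, so \<open>x powr a \<le> x\<close>; and \<open>a * K \<le> 2\<close>, so the other term can be compared
  with the square \<open>(1 - x)\<^sup>2 \<ge> 1 - 2 * x\<close>.
\<close>

lemma increment_le:
  fixes x a K :: real
  assumes "0 \<le> x" "x \<le> 1" "0 < K" "K \<le> 1" "1 \<le> a * K" "a \<le> 2"
  shows "(1 + x powr a) powr K - (1 - x) powr (a * K) \<le> 3 * x"
proof -
  have "1 \<le> a"
    using assms by (smt (verit) mult_left_le mult_nonneg_nonneg mult_nonpos_nonneg)
  have "(1 + x powr a) powr K \<le> (1 + x powr a) powr 1"
    using assms by (intro powr_mono) auto
  also have "\<dots> = 1 + x powr a" by simp
  also have "\<dots> \<le> 1 + x"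
    using powr_mono'[of 1 a x] assms \<open>1 \<le> a\<close> by simp
  finally have *: "(1 + x powr a) powr K \<le> 1 + x" .
  have "a * K \<le> 2 * 1" using assms \<open>1 \<le> a\<close> by (intro mult_mono) auto
  then have "(1 - x) powr 2 \<le> (1 - x) powr (a * K)"
    using assms by (intro powr_mono') auto
  moreover have "1 - 2 * x \<le> (1 - x) powr 2"
    using assms by (simp add: power2_eq_square algebra_simps)
  ultimately show ?thesis using * by linarith
qed

section \<open>Correlations of the process\<close>

lemma R_cov_same:
  assumes "0 < H t" "H t < 1" "0 < t"
  shows "R_cov H K t t = (t powr (H t * K))\<^sup>2"
proof -
  have "R_cov H K t t = (1 / 2) powr K * (2 * t powr (2 * H t)) powr K"
    using assms by (simp add: R_cov_def D_factor_same)
  also have "\<dots> = (t powr (2 * H t)) powr K"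
    by (simp flip: powr_mult)
  also have "\<dots> = (t powr (H t * K))\<^sup>2"
    by (simp add: powr_powr power2_eq_square flip: powr_add) (simp add: algebra_simps)
  finally show ?thesis .
qed

lemma cor_bifractional_mbm:
  assumes B: "bifractional_mbm M H K B" and H: "H \<in> {0..} \<rightarrow> {0<..<1}"
    and s: "0 < s" and t: "s \<le> t"
  shows "cor M B s t = D_factor (H s) (H t) powr K * (t / s) powr (K * H s) *
    ((1 + (s / t) powr (H s + H t)) powr K - (1 - s / t) powr ((H s + H t) * K))"
proof -
  define a where "a = H s + H t"
  define x where "x = s / t"
  have t0: "0 < t" using s t by simp
  have x: "0 < x" "x \<le> 1" and sx: "s = t * x" using s t by (auto simp: x_def)
  have second_moment: "(LINT \<omega>|M. (B r \<omega>)\<^sup>2) = (r powr (H r * K))\<^sup>2" if "0 < r" for r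
  proof -
    have "(LINT \<omega>|M. (B r \<omega>)\<^sup>2) = covariance M (B r) (B r)"
      using B that by (simp add: bifractional_mbm_def covariance_def power2_eq_square)
    also have "\<dots> = R_cov H K r r"
      using B that by (simp add: bifractional_mbm_def)
    finally show ?thesis using R_cov_same[of H r K] H that by (auto simp: Pi_iff)
  qed
  have "cor M B s t = R_cov H K s t / (s powr (H s * K) * t powr (H t * K))"
    unfolding cor_def second_moment[OF s] second_moment[OF t0]
    using B s t0 by (simp add: bifractional_mbm_def real_sqrt_mult)
  also have "R_cov H K s t = D_factor (H s) (H t) powr K *
      (t powr (a * K) * ((1 + x powr a) powr K - (1 - x) powr (a * K)))"
  proof -
    have "s powr a + t powr a = t powr a * (1 + x powr a)"
      using t0 x by (simp add: sx powr_mult algebra_simps)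
    moreover have "\<bar>s - t\<bar> = t * (1 - x)"
      using t0 x by (simp add: sx abs_if algebra_simps)
    ultimately have "R_cov H K s t = D_factor (H s) (H t) powr K *
        ((t powr a * (1 + x powr a)) powr K - (t * (1 - x)) powr (a * K))"
      by (simp only: R_cov_def a_def)
    also have "(t powr a * (1 + x powr a)) powr K = t powr (a * K) * (1 + x powr a) powr K"
      using t0 by (simp add: powr_mult powr_powr)
    also have "(t * (1 - x)) powr (a * K) = t powr (a * K) * (1 - x) powr (a * K)"
      by (rule powr_mult)
    finally show ?thesis by (simp add: right_diff_distrib)
  qed
  also have "t powr (a * K) = t powr (K * H s) * t powr (H t * K)"
    by (simp add: a_def algebra_simps flip: powr_add)
  finally show ?thesis
    using s t0 by (simp add: x_def a_def powr_divide mult_ac)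
qed

section \<open>Two-sided bounds for the correlations\<close>

text \<open>
  With \<open>e = K * H s\<close>, this turns a bound \<open>q * (s / t)\<close> on the increment into a bound on the
  correlation of the form constant times \<open>t powr (K * H s - 1)\<close>, where the constant depends on
  \<open>s\<close> but not on \<open>t\<close>.
\<close>

lemma powr_ratio_rearrange:
  fixes s t e l q :: real
  assumes "0 < s" "0 < t"
  shows "l * (t / s) powr e * (q * (s / t)) = l * s powr (1 - e) * q * t powr (e - 1)"
  using assms by (simp add: powr_divide powr_diff field_simps)

lemma cor_bifractional_mbm_ge:
  assumes B: "bifractional_mbm M H K B" and K: "0 < K" "K \<le> 1"
    and H: "H \<in> {0..} \<rightarrow> {\<mu>..\<nu>}" and \<mu>: "0 < \<mu>" and \<nu>: "\<nu> < 1" and s: "0 < s"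
  obtains c where "0 < c" "\<And>t. s \<le> t \<Longrightarrow> c * t powr (K * H s - 1) \<le> cor M B s t"
proof -
  obtain l where l: "0 < l" "\<And>x y. x \<in> {\<mu>..\<nu>} \<Longrightarrow> y \<in> {\<mu>..\<nu>} \<Longrightarrow> l \<le> D_factor x y"
    using D_factor_bounds[OF \<mu> \<nu>] by metis
  have H01: "H \<in> {0..} \<rightarrow> {0<..<1}"
    using H \<mu> \<nu> by (force simp: Pi_iff)
  define c where "c = l powr K * s powr (1 - K * H s) * (K * \<mu>)"
  have "0 < c" using l s K \<mu> by (simp add: c_def)
  moreover have "c * t powr (K * H s - 1) \<le> cor M B s t" if t: "s \<le> t" for t
  proof -
    have t0: "0 < t" using s t by simp
    have Hs: "\<mu> \<le> H s" "H s \<le> \<nu>" and Ht: "\<mu> \<le> H t" using H s t0 by (auto simp: Pi_iff)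
    have "K * \<mu> \<le> 1 * 1" "\<mu> * K \<le> (H s + H t) * K"
      using Hs Ht K \<mu> \<nu> by (intro mult_mono mult_right_mono; linarith)+
    then have "K * \<mu> * (s / t) \<le> (1 + (s / t) powr (H s + H t)) powr K
        - (1 - s / t) powr ((H s + H t) * K)"
      using s t K \<mu> by (intro increment_ge) (auto simp: mult_ac)
    moreover have "l powr K \<le> D_factor (H s) (H t) powr K"
      using l K H s t0 by (intro powr_mono2) (auto simp: Pi_iff)
    ultimately have "l powr K * (t / s) powr (K * H s) * (K * \<mu> * (s / t)) \<le> cor M B s t"
      unfolding cor_bifractional_mbm[OF B H01 s t]
      using s t0 K \<mu> by (intro mult_mono) auto
    then show ?thesis
      unfolding c_def powr_ratio_rearrange[OF s t0] .
  qed
  ultimately show ?thesis using that by blast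
qed

lemma cor_bifractional_mbm_le:
  assumes B: "bifractional_mbm M H K B" and K: "0 < K" "K \<le> 1"
    and H: "H \<in> {0..} \<rightarrow> {\<mu>..\<nu>}" and \<mu>: "0 < \<mu>" and \<nu>: "\<nu> < 1" and s: "0 < s"
  obtains d where
    "\<And>t. s \<le> t \<Longrightarrow> 1 \<le> K * (H t + H s) \<Longrightarrow> cor M B s t \<le> d * t powr (K * H s - 1)"
proof -
  obtain u l where u: "0 < l" "\<And>x y. x \<in> {\<mu>..\<nu>} \<Longrightarrow> y \<in> {\<mu>..\<nu>} \<Longrightarrow> D_factor x y \<le> u"
      "\<And>x y. x \<in> {\<mu>..\<nu>} \<Longrightarrow> y \<in> {\<mu>..\<nu>} \<Longrightarrow> l \<le> D_factor x y"
    using D_factor_bounds[OF \<mu> \<nu>] by metis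
  have H01: "H \<in> {0..} \<rightarrow> {0<..<1}"
    using H \<mu> \<nu> by (force simp: Pi_iff)
  have "cor M B s t \<le> u powr K * s powr (1 - K * H s) * 3 * t powr (K * H s - 1)"
    if t: "s \<le> t" and large: "1 \<le> K * (H t + H s)" for t
  proof -
    have t0: "0 < t" using s t by simp
    have "(1 + (s / t) powr (H s + H t)) powr K - (1 - s / t) powr ((H s + H t) * K) \<le> 3 * (s / t)"
    proof (rule increment_le)
      have "H s < 1" "H t < 1" using H01 s t0 by (auto simp: Pi_iff)
      then show "H s + H t \<le> 2" by simp
      show "1 \<le> (H s + H t) * K" using large by (simp add: algebra_simps)
    qed (use s t K in auto)
    moreover have "0 \<le> D_factor (H s) (H t)"
      using u(1) u(3)[of "H s" "H t"] H s t0 by (force simp: Pi_iff)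
    then have "D_factor (H s) (H t) powr K \<le> u powr K"
      using u K H s t0 by (intro powr_mono2) (auto simp: Pi_iff)
    ultimately have "cor M B s t \<le> D_factor (H s) (H t) powr K * (t / s) powr (K * H s) * (3 * (s / t))"
      "D_factor (H s) (H t) powr K * (t / s) powr (K * H s) * (3 * (s / t))
        \<le> u powr K * (t / s) powr (K * H s) * (3 * (s / t))"
      unfolding cor_bifractional_mbm[OF B H01 s t]
      using s t0 by (intro mult_left_mono mult_right_mono; simp)+
    then have "cor M B s t \<le> u powr K * (t / s) powr (K * H s) * (3 * (s / t))"
      by (rule order.trans)
    then show ?thesis
      unfolding powr_ratio_rearrange[OF s t0] .
  qed
  then show ?thesis using that by blast
qed

section \<open>Long range dependence\<close>

text \<open>
  Since \<open>s + k * \<delta> \<le> (s + \<delta>) * (k + 1)\<close>, the terms dominate a multiple of the harmonic series,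
  whether or not \<open>\<delta>\<close> vanishes.
\<close>

lemma suminf_ennreal_arith_progression_eq_infinity:
  fixes C s \<delta> :: real
  assumes C: "0 < C" and s: "0 < s" and \<delta>: "0 \<le> \<delta>"
    and le: "\<And>k. C / (s + real k * \<delta>) \<le> f k"
  shows "(\<Sum>k. ennreal (f k)) = \<infinity>"
proof (rule ccontr)
  assume "(\<Sum>k. ennreal (f k)) \<noteq> \<infinity>"
  moreover have nonneg: "0 \<le> C / (s + real k * \<delta>)" for k
    using C s \<delta> by simp
  then have f: "0 \<le> f k" for k
    using le order.trans by blast
  ultimately have "summable f"
    using summable_suminf_not_top[of f] by simp
  have harmonic_le: "C / (s + \<delta>) * inverse (real (Suc k)) \<le> f k" for k
  proof -
    have "s + real k * \<delta> \<le> (s + \<delta>) * real (Suc k)"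
      using s \<delta> by (simp add: algebra_simps)
    then have "C / ((s + \<delta>) * real (Suc k)) \<le> C / (s + real k * \<delta>)"
      using C s \<delta> by (intro divide_left_mono mult_pos_pos) (auto intro: add_pos_nonneg)
    also have "\<dots> \<le> f k" by (rule le)
    finally show ?thesis by (simp add: divide_inverse mult_ac)
  qed
  have "summable (\<lambda>k. C / (s + \<delta>) * inverse (real (Suc k)))"
    using C s \<delta> harmonic_le f
    by (intro summable_comparison_test'[OF \<open>summable f\<close>, of 0])
       (simp del: of_nat_Suc)
  moreover have "C / (s + \<delta>) \<noteq> 0" using C s \<delta> by simp
  ultimately have "summable (\<lambda>k. inverse (real (Suc k)))"
    by (simp only: summable_cmult_iff) simp
  then show False
    using not_summable_harmonic[where 'a = real] summable_Suc_iff[of "\<lambda>n. inverse (real n)"]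
    by simp
qed

text \<open>
  Bounds in the time \<open>t = s + h\<close> transfer to the lag \<open>h\<close>, because \<open>h \<le> s + h \<le> 2 * h\<close> once
  \<open>h \<ge> s\<close>.
\<close>

lemma same_order_at_top_shift:
  fixes f :: "real \<Rightarrow> real" and s c d \<alpha> :: real
  assumes s: "0 \<le> s" and \<alpha>: "\<alpha> \<le> 0" and c: "0 < c"
    and lower: "\<forall>\<^sub>F t in at_top. c * t powr \<alpha> \<le> f t"
    and upper: "\<forall>\<^sub>F t in at_top. f t \<le> d * t powr \<alpha>"
  shows "same_order_at_top (\<lambda>h. f (s + h)) (\<lambda>h. h powr \<alpha>)"
proof -
  have shift: "filterlim (\<lambda>h. s + h) at_top (at_top :: real filter)"
    by (rule filterlim_tendsto_add_at_top[OF tendsto_const filterlim_ident])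
  \<comment> \<open>The maximum enforces the strict inequality between the two constants.\<close>
  define c' d' where "c' = c * 2 powr \<alpha>" and "d' = max d (2 * c')"
  have c': "0 < c'" using c by (simp add: c'_def)
  have "\<forall>\<^sub>F h in at_top. c' \<le> f (s + h) / h powr \<alpha> \<and> f (s + h) / h powr \<alpha> \<le> d'"
    using filterlim_iff[THEN iffD1, OF shift, rule_format, OF lower]
      filterlim_iff[THEN iffD1, OF shift, rule_format, OF upper]
      eventually_gt_at_top[of 0] eventually_ge_at_top[of s]
  proof eventually_elim
    case (elim h)
    have h: "0 < h powr \<alpha>" using elim by simp
    have "c' * h powr \<alpha> = c * (2 * h) powr \<alpha>"
      using elim by (simp add: c'_def powr_mult)
    also have "\<dots> \<le> c * (s + h) powr \<alpha>"
      using elim s c \<alpha> by (intro mult_left_mono powr_mono2') auto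
    also have "\<dots> \<le> f (s + h)" by (rule elim)
    finally have ge: "c' * h powr \<alpha> \<le> f (s + h)" .
    have "f (s + h) \<le> d * (s + h) powr \<alpha>" by (rule elim)
    also have "\<dots> \<le> d' * (s + h) powr \<alpha>"
      by (intro mult_right_mono) (auto simp: d'_def)
    also have "\<dots> \<le> d' * h powr \<alpha>"
      using elim s c' \<alpha> by (intro mult_left_mono powr_mono2') (auto simp: d'_def)
    finally have le: "f (s + h) \<le> d' * h powr \<alpha>" .
    from ge le h show ?case by (simp add: pos_le_divide_eq pos_divide_le_eq)
  qed
  moreover have "c' < d'" using c' by (auto simp: d'_def)
  ultimately show ?thesis
    unfolding same_order_at_top_def using c' by blast
qed

theorem corollary1:
  fixes M :: "'a measure" and B :: "real \<Rightarrow> 'a \<Rightarrow> real"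
    and H :: "real \<Rightarrow> real" and K \<mu> \<nu> \<beta> :: real
  assumes "K \<in> {0<..1}"
    and "{\<mu>..\<nu>} \<subseteq> {0<..<1}"
    and "H \<in> {0..} \<rightarrow> {\<mu>..\<nu>}"
    and "\<beta> > 0"
    and "hoelder_continuous_on \<beta> {0..} H"
    and "bifractional_mbm M H K B"
  shows "long_range_dependent_b M B \<and>
    ((\<forall>s\<ge>0. \<forall>\<^sub>F t in at_top. K * (H t + H s) > 1) \<longrightarrow>
       long_range_dependent_a M B \<and> lrd_functional_exponent M B (\<lambda>s. K * H s - 1))"
proof (intro conjI impI)
  have K: "0 < K" "K \<le> 1" using assms(1) by auto
  note H = assms(3)
  \<comment> \<open>The interval contains \<open>H 0\<close>, so its end points lie in it and hence in the open unit interval.\<close>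
  have "\<mu> \<le> \<nu>" using H by (force simp: Pi_iff)
  then have \<mu>: "0 < \<mu>" and \<nu>: "\<nu> < 1" using assms(2) by auto
  note B = assms(6)
  have ex: "K * H s - 1 \<in> {-1<..<0}" if "0 \<le> s" for s
  proof -
    have Hs: "0 < H s" "H s < 1" using H that \<mu> \<nu> by (force simp: Pi_iff)+
    then have "K * H s \<le> 1 * H s" "0 < K * H s"
      using K by (intro mult_right_mono mult_pos_pos; simp)+
    then have "K * H s < 1" using Hs by linarith
    then show ?thesis using \<open>0 < K * H s\<close> by simp
  qed
  show "long_range_dependent_b M B"
    unfolding long_range_dependent_b_def
  proof (intro allI impI)
    fix s \<delta> :: real
    assume s: "0 < s" and \<delta>: "0 \<le> \<delta>"
    obtain c where c: "0 < c" "\<And>t. s \<le> t \<Longrightarrow> c * t powr (K * H s - 1) \<le> cor M B s t"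
      using cor_bifractional_mbm_ge[OF B K H \<mu> \<nu> s] by metis
    show "(\<Sum>k. ennreal \<bar>cor M B s (s + real k * \<delta>)\<bar>) = \<infinity>"
    proof (rule suminf_ennreal_arith_progression_eq_infinity[OF _ s \<delta>])
      show "0 < c * s powr (K * H s)" using c s by simp
    next
      fix k
      define t where "t = s + real k * \<delta>"
      have t: "s \<le> t" using \<delta> by (simp add: t_def)
      have "s powr (K * H s) \<le> t powr (K * H s)"
        using s t ex[of s] by (intro powr_mono2) auto
      then have "c * s powr (K * H s) / t \<le> c * t powr (K * H s) / t"
        using c s t by (intro divide_right_mono mult_left_mono) auto
      also have "\<dots> = c * t powr (K * H s - 1)"
        using s t by (simp add: powr_diff)
      also have "\<dots> \<le> \<bar>cor M B s t\<bar>" using c(2)[OF t] by linarith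
      finally show "c * s powr (K * H s) / (s + real k * \<delta>) \<le> \<bar>cor M B s (s + real k * \<delta>)\<bar>"
        unfolding t_def .
    qed
  qed
  assume large: "\<forall>s\<ge>0. \<forall>\<^sub>F t in at_top. K * (H t + H s) > 1"
  show "lrd_functional_exponent M B (\<lambda>s. K * H s - 1)"
    unfolding lrd_functional_exponent_def
  proof (intro conjI allI impI)
    fix s :: real assume "0 \<le> s"
    then show "K * H s - 1 \<in> {-1<..<0}" by (rule ex)
  next
    fix s :: real assume s: "0 < s"
    obtain c where c: "0 < c" "\<And>t. s \<le> t \<Longrightarrow> c * t powr (K * H s - 1) \<le> cor M B s t"
      using cor_bifractional_mbm_ge[OF B K H \<mu> \<nu> s] by metis
    obtain d where d:
      "\<And>t. s \<le> t \<Longrightarrow> 1 \<le> K * (H t + H s) \<Longrightarrow> cor M B s t \<le> d * t powr (K * H s - 1)"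
      using cor_bifractional_mbm_le[OF B K H \<mu> \<nu> s] by metis
    show "same_order_at_top (\<lambda>h. cor M B s (s + h)) (\<lambda>h. h powr (K * H s - 1))"
    proof (rule same_order_at_top_shift[where f = "\<lambda>t. cor M B s t", OF _ _ c(1)])
      show "\<forall>\<^sub>F t in at_top. c * t powr (K * H s - 1) \<le> cor M B s t"
        using eventually_ge_at_top[of s] by eventually_elim (rule c(2))
      have "\<forall>\<^sub>F t in at_top. K * (H t + H s) > 1" using large s by simp
      then show "\<forall>\<^sub>F t in at_top. cor M B s t \<le> d * t powr (K * H s - 1)"
        using eventually_ge_at_top[of s] by eventually_elim (rule d, auto)
    qed (use s ex[of s] in auto)
  qed
  then show "long_range_dependent_a M B"
    unfolding long_range_dependent_a_def by blast
qed

end
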